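(* Let $a,c,h$ be positive integers and $b\ge 0$ an integer, with $c>1$, and let $n=c2^h$. Assume that $1\le a\le 2^{h-1}$ and $k=b2^h+a<n$. Set $f(b,c)=\sigma_2(b)-\sigma_2(c)+\nu_2\left(\binom{2c-b-1}{c}\right)$. If $2^{h-2}\ge \nu_2\left(\binom{2c-b-1}{c}\right)$, then $$\nu_2(S(n,k))=\sigma_2(k)-\sigma_2(n)+\nu_2\left(\binom{n-k+n}{n}\right)=\sigma_2(a)+f(b,c).$$ If moreover $b$ is odd, then this common value equals $$\sigma_2(a)+\nu_2(c-b)+\nu_2\left(\binom{2c-b}{b}\right),$$ since then $f(b,c)=\nu_2(c-b)+\nu_2\left(\binom{2c-b}{b}\right)$.
   Context: $S(n,k)$ is the Stirling number of the second kind. $\sigma_2(m)$ is the sum of the base $2$ digits of the nonnegative integer $m$, and $\nu_2$ is the $2$-adic valuation. *)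

theory Defs
  imports Complex_Main "HOL-Computational_Algebra.Primes" "HOL-Combinatorics.Stirling"
begin

abbreviation nu2 :: "nat \<Rightarrow> nat" where
  "nu2 m \<equiv> multiplicity 2 m"

text \<open>The digit of weight \<open>2 ^ i\<close> is \<open>m div 2 ^ i mod 2\<close>; since \<open>m < 2 ^ m\<close>,
  all digits with \<open>i \<ge> m\<close> vanish.\<close>

definition sigma2 :: "nat \<Rightarrow> nat" where
  "sigma2 m = (\<Sum>i<m. m div 2 ^ i mod 2)"

text \<open>Integer-valued, as the difference of digit sums may be negative. The natural number
  subtraction is the true one whenever \<open>b < c\<close>.\<close>

definition f_shift :: "nat \<Rightarrow> nat \<Rightarrow> int" where
  "f_shift b c = int (sigma2 b) - int (sigma2 c) + int (nu2 ((2 * c - b - 1) choose c))"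

end

theory Submission
  imports Defs "HOL-Computational_Algebra.Formal_Power_Series"
begin

text \<open>
  Put \<open>F = log (1 + 2v) / (2v)\<close> (\<open>log_fps\<close>) and \<open>Q = 1 / (1 + 2v)\<close> (\<open>geo_fps\<close>). Lagrange inversion gives
  \<open>S(n,k) k! 2 ^ (n - k) = n! [v ^ (n - k)] Q F ^ (-n-1)\<close>. Since \<open>F = 1 - v H\<close>
  with \<open>H = 1 - 4/3 v + \<dots>\<close> (\<open>tail_fps\<close>),
  the coefficient of \<open>v ^ m\<close> in \<open>Q F ^ (-n-1)\<close> is the sum over \<open>i \<le> m\<close> of \<open>binomial (n + i) n\<close> times
  the coefficient of \<open>v ^ (m - i)\<close> in \<open>Q H ^ i\<close>. The latter is 1 for \<open>i = m\<close>, and in general it is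
  divisible by 2 to the power \<open>\<lceil>(m - i) / 2\<rceil>\<close>. For \<open>n = c 2 ^ h\<close> and
  \<open>m = n - k = (c - b - 1) 2 ^ h + (2 ^ h - a)\<close>, the binomials with \<open>i \<ge> (c - b - 1) 2 ^ h\<close> all have
  the valuation \<open>\<nu>\<close> of \<open>binomial (2c - b - 1) c\<close>, while for smaller \<open>i\<close> we have
  \<open>m - i > 2 ^ (h - 1) \<ge> 2 \<nu>\<close>; so the term \<open>i = m\<close>, which is \<open>binomial (2n - k) n\<close>, determines the
  valuation of the whole sum. The digit sums enter through Legendre's formula for \<open>\<nu>\<^sub>2 (m!)\<close>.
\<close>

unbundle fps_syntax

section \<open>Logarithmic power series and the Stirling numbers\<close>

definition log_fps :: "rat fps" where
  "log_fps = Abs_fps (\<lambda>i. (-2) ^ i / of_nat (Suc i))"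

definition geo_fps :: "rat fps" where
  "geo_fps = Abs_fps (\<lambda>i. (-2) ^ i)"

definition tail_fps :: "rat fps" where
  "tail_fps = Abs_fps (\<lambda>i. - ((-2) ^ Suc i) / of_nat (i + 2))"

lemma log_fps_eq_tail: "log_fps = 1 - fps_X * tail_fps"
proof (rule fps_ext)
  fix i show "log_fps $ i = (1 - fps_X * tail_fps) $ i"
    by (cases i) (simp_all add: log_fps_def tail_fps_def)
qed

text \<open>Derivative of 2vF = log (1 + 2v), halved: (vF)' = Q.\<close>

lemma log_fps_deriv: "log_fps + fps_X * fps_deriv log_fps = geo_fps"
proof (rule fps_ext)
  fix i
  have "(log_fps + fps_X * fps_deriv log_fps) $ i = of_nat (Suc i) * log_fps $ i"
    by (cases i) (simp_all add: algebra_simps)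
  then show "(log_fps + fps_X * fps_deriv log_fps) $ i = geo_fps $ i"
    by (simp add: log_fps_def geo_fps_def del: of_nat_Suc)
qed

text \<open>Comes from (1 + 2v) Q = 1. The two terms on the right will match those of the Stirling
  recurrence.\<close>

lemma geo_fps_mult_nth_Suc:
  "a $ Suc i = (geo_fps * a) $ Suc i + 2 * (geo_fps * a) $ i"
proof -
  have "geo_fps + 2 * fps_X * geo_fps = 1"
  proof (rule fps_ext)
    fix i show "(geo_fps + 2 * fps_X * geo_fps) $ i = 1 $ i"
      by (cases i) (simp_all add: geo_fps_def mult.assoc numeral_fps_const)
  qed
  then have "a = geo_fps * a + 2 * (fps_X * (geo_fps * a))"
    by (metis distrib_right mult.assoc mult_1)
  then have "a $ Suc i = (geo_fps * a + 2 * (fps_X * (geo_fps * a))) $ Suc i"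
    by simp
  then show ?thesis by (simp add: numeral_fps_const)
qed

lemma log_fps_inverse: "inverse log_fps * log_fps = 1"
  by (rule inverse_mult_eq_1) (simp add: log_fps_def)

lemma inverse_log_fps_deriv:
  "fps_X * fps_deriv (inverse log_fps) = inverse log_fps - geo_fps * (inverse log_fps)\<^sup>2"
proof -
  let ?W = "inverse log_fps"
  have "fps_deriv ?W = - fps_deriv log_fps * ?W\<^sup>2"
    by (rule fps_inverse_deriv) (simp add: log_fps_def)
  then have "fps_X * fps_deriv ?W = - (fps_X * fps_deriv log_fps) * ?W\<^sup>2"
    by (simp add: algebra_simps)
  also have "\<dots> = (log_fps - geo_fps) * ?W\<^sup>2"
    by (simp flip: log_fps_deriv)
  also have "\<dots> = (?W * log_fps) * ?W - geo_fps * ?W\<^sup>2"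
    by (simp add: algebra_simps power2_eq_square)
  finally show ?thesis by (simp add: log_fps_inverse)
qed

lemma inverse_log_fps_power_nth:
  "of_nat (Suc n) * (geo_fps * inverse log_fps ^ Suc (Suc n)) $ m
     = (of_nat (Suc n) - of_nat m) * (inverse log_fps ^ Suc n) $ m"
proof -
  let ?W = "inverse log_fps"
  have "fps_X * fps_deriv (?W ^ Suc n) = of_nat (Suc n) * ?W ^ n * (fps_X * fps_deriv ?W)"
    unfolding fps_deriv_power' by (simp add: ac_simps del: of_nat_Suc)
  also have "\<dots> = of_nat (Suc n) * (?W ^ Suc n - geo_fps * ?W ^ Suc (Suc n))"
    unfolding inverse_log_fps_deriv by (simp add: algebra_simps power2_eq_square)
  finally have "(fps_X * fps_deriv (?W ^ Suc n)) $ m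
      = (of_nat (Suc n) * (?W ^ Suc n - geo_fps * ?W ^ Suc (Suc n))) $ m"
    by simp
  then have "of_nat m * (?W ^ Suc n) $ m
      = of_nat (Suc n) * ((?W ^ Suc n) $ m - (geo_fps * ?W ^ Suc (Suc n)) $ m)"
    unfolding fps_mult_fps_X_deriv_shift fps_nth_Abs_fps
    by (simp only: fps_of_nat[symmetric] fps_mult_left_const_nth fps_sub_nth)
  then show ?thesis
    by (simp only: algebra_simps)
qed

text \<open>The preceding identity, obtained from \<open>v W' = W - Q W\<^sup>2\<close> for \<open>W = 1 / F\<close>,
  replaces Lagrange inversion: it turns the right-hand side below
  into a solution of the Stirling recurrence.\<close>

lemma Stirling_eq_fps_coeff:
  "k \<le> n \<Longrightarrow> of_nat (Stirling n k) * fact k * 2 ^ (n - k)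
     = (fact n * (geo_fps * inverse log_fps ^ Suc n) $ (n - k) :: rat)"
proof (induction n arbitrary: k)
  case 0
  then show ?case by (simp add: geo_fps_def log_fps_def)
next
  case (Suc n)
  let ?W = "inverse log_fps"
  let ?B = "geo_fps * ?W ^ Suc n"
  have rec: "fact (Suc n) * (geo_fps * ?W ^ Suc (Suc n)) $ m
      = fact n * ((of_nat (Suc n) - of_nat m) * (?W ^ Suc n) $ m)" for m
    unfolding inverse_log_fps_power_nth[symmetric] by simp
  show ?case
  proof (cases k)
    \<comment> \<open>Here m = n + 1, so the factor \<open>of_nat (Suc n) - of_nat m\<close> in
      \<open>rec\<close> vanishes, as does \<open>Stirling (Suc n) 0\<close>.\<close>
    case 0
    then show ?thesis by (simp add: rec del: power_Suc fact_Suc of_nat_Suc)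
  next
    case (Suc j)
    then have j: "j \<le> n" using Suc.prems by simp
    have "fact (Suc n) * (geo_fps * ?W ^ Suc (Suc n)) $ (Suc n - k)
        = fact n * (of_nat (Suc j) * (?W ^ Suc n) $ (n - j))"
      unfolding rec using Suc j by (simp add: of_nat_diff)
    also have "\<dots> = of_nat (Suc j) * (fact n * (?W ^ Suc n) $ (n - j))"
      by simp
    also have "fact n * (?W ^ Suc n) $ (n - j)
        = fact j * 2 ^ (n - j) * (of_nat (Stirling n j) + of_nat (Suc j * Stirling n (Suc j)))"
    \<comment> \<open>For n = j only the constant coefficient is left, where
      \<open>geo_fps_mult_nth_Suc\<close> does not apply; there \<open>Stirling n (Suc n)\<close> is
      0.\<close>
    proof (cases "n = j")
      case True
      then show ?thesis by (simp add: fps_power_zeroth log_fps_def del: power_Suc)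
    next
      case False
      then obtain i where i: "n - j = Suc i" "n - Suc j = i"
        using j by (cases "n - j") auto
      then have "Suc j \<le> n" by simp
      define x y where "x = ?B $ (n - j)" and "y = ?B $ (n - Suc j)"
      have "fact n * (?W ^ Suc n) $ (n - j) = fact n * x + 2 * (fact n * y)"
        unfolding x_def y_def i geo_fps_mult_nth_Suc[of "?W ^ Suc n"] by (simp only: algebra_simps)
      also have "\<dots> = fact j * 2 ^ (n - j) * (of_nat (Stirling n j) + of_nat (Suc j * Stirling n (Suc j)))"
        using Suc.IH[OF j, folded x_def] Suc.IH[OF \<open>Suc j \<le> n\<close>, folded y_def] unfolding i
        by (simp add: algebra_simps)
      finally show ?thesis .
    qed
    finally show ?thesis using Suc
      by (simp add: algebra_simps del: power_Suc)
  qed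
qed

text \<open>Substitutes vH for x in the binomial series of (1 - x)^(-n-1), then multiplies by Q; the
  factor v^i shifts the index to m - i.\<close>

lemma inverse_log_fps_power_expansion:
  "(geo_fps * inverse log_fps ^ Suc n) $ m
     = (\<Sum>i\<le>m. of_nat ((n + i) choose n) * (geo_fps * tail_fps ^ i) $ (m - i))"
proof -
  let ?Y = "fps_X * tail_fps"
  define G where "G = Abs_fps (\<lambda>k. of_nat ((n + k) choose k) :: rat)"
  have G: "inverse ((1 - fps_X) ^ Suc n) = G"
    using one_minus_const_fps_X_neg_power'[of "Suc n" "1::rat"] by (simp add: G_def)
  have "inverse log_fps ^ Suc n = inverse (log_fps ^ Suc n)"
    by (simp add: fps_inverse_power del: power_Suc)
  also have "\<dots> = inverse (((1 - fps_X) oo ?Y) ^ Suc n)"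
    by (simp add: fps_compose_sub_distrib log_fps_eq_tail)
  also have "\<dots> = inverse ((1 - fps_X) ^ Suc n) oo ?Y"
    by (subst fps_compose_power, simp) (rule fps_inverse_compose[symmetric], simp_all)
  also have "\<dots> = G oo ?Y" by (simp only: G)
  finally have W: "inverse log_fps ^ Suc n = G oo ?Y" .
  have Yn: "(?Y ^ i) $ l = (if l < i then 0 else (tail_fps ^ i) $ (l - i))" for i l
    by (simp add: power_mult_distrib fps_X_power_mult_nth)
  \<comment> \<open>(vH)^i has no terms of degree below i, so the range i \<le> l may grow to i
    \<le> m; a range independent of l allows the sums to be swapped.\<close>
  have W': "(inverse log_fps ^ Suc n) $ l = (\<Sum>i\<le>m. G $ i * (?Y ^ i) $ l)" if "l \<le> m" for l
    unfolding W fps_compose_nth using that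
    by (intro sum.mono_neutral_left) (auto simp: Yn)
  have "(geo_fps * inverse log_fps ^ Suc n) $ m
      = (\<Sum>l=0..m. geo_fps $ l * (\<Sum>i\<le>m. G $ i * (?Y ^ i) $ (m - l)))"
    unfolding fps_mult_nth[of geo_fps] by (intro sum.cong) (simp_all add: W' del: power_Suc)
  also have "\<dots> = (\<Sum>i\<le>m. G $ i * (\<Sum>l=0..m. geo_fps $ l * (?Y ^ i) $ (m - l)))"
    unfolding sum_distrib_left by (subst sum.swap) (simp add: algebra_simps)
  also have "\<dots> = (\<Sum>i\<le>m. G $ i * (geo_fps * ?Y ^ i) $ m)"
    by (simp only: fps_mult_nth[of geo_fps])
  also have "\<dots> = (\<Sum>i\<le>m. G $ i * (geo_fps * tail_fps ^ i) $ (m - i))"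
  proof (intro sum.cong refl)
    fix i assume "i \<in> {..m}"
    have "geo_fps * ?Y ^ i = fps_X ^ i * (geo_fps * tail_fps ^ i)"
      by (simp only: power_mult_distrib mult.left_commute)
    then show "G $ i * (geo_fps * ?Y ^ i) $ m = G $ i * (geo_fps * tail_fps ^ i) $ (m - i)"
      using \<open>i \<in> {..m}\<close> by (simp only: fps_X_power_mult_nth) simp
  qed
  also have "\<dots> = (\<Sum>i\<le>m. of_nat ((n + i) choose n) * (geo_fps * tail_fps ^ i) $ (m - i))"
    by (intro sum.cong refl) (simp add: G_def binomial_symmetric[of n])
  finally show ?thesis .
qed

section \<open>2-adic divisibility of the coefficients\<close>

text \<open>The ideal generated by \<open>2 ^ e\<close> in the localization of the integers at 2.\<close>

definition two_pow_ideal :: "nat \<Rightarrow> rat set" where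
  "two_pow_ideal e = {x. \<exists>p q. odd q \<and> of_int q * x = 2 ^ e * of_int p}"

lemma two_pow_idealI: "odd q \<Longrightarrow> of_int q * x = 2 ^ e * of_int p \<Longrightarrow> x \<in> two_pow_ideal e"
  by (auto simp: two_pow_ideal_def)

lemma two_pow_ideal_mono:
  assumes "x \<in> two_pow_ideal e" "e' \<le> e" shows "x \<in> two_pow_ideal e'"
proof -
  obtain p q where "odd q" "of_int q * x = 2 ^ e * of_int p"
    using assms by (auto simp: two_pow_ideal_def)
  moreover have "(2::rat) ^ e = 2 ^ e' * 2 ^ (e - e')"
    using assms(2) by (simp flip: power_add)
  ultimately show ?thesis
    by (intro two_pow_idealI[of q _ _ "2 ^ (e - e') * p"]) simp_all
qed

lemma two_pow_ideal_0 [simp]: "0 \<in> two_pow_ideal e"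
  by (rule two_pow_idealI[of 1 _ _ 0]) simp_all

lemma two_pow_ideal_add:
  assumes "x \<in> two_pow_ideal e" "y \<in> two_pow_ideal e" shows "x + y \<in> two_pow_ideal e"
proof -
  obtain p q p' q' where 1: "odd q" "of_int q * x = 2 ^ e * of_int p"
      and 2: "odd q'" "of_int q' * y = 2 ^ e * of_int p'"
    using assms by (auto simp: two_pow_ideal_def)
  have "of_int (q * q') * (x + y) = of_int q' * (of_int q * x) + of_int q * (of_int q' * y)"
    by (simp add: algebra_simps)
  also have "\<dots> = 2 ^ e * of_int (q' * p + q * p')"
    unfolding 1 2 by (simp add: algebra_simps)
  finally show ?thesis by (rule two_pow_idealI[rotated]) (use 1 2 in simp)
qed

lemma two_pow_ideal_mult:
  assumes "x \<in> two_pow_ideal e" "y \<in> two_pow_ideal e'" shows "x * y \<in> two_pow_ideal (e + e')"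
proof -
  obtain p q p' q' where 1: "odd q" "of_int q * x = 2 ^ e * of_int p"
      and 2: "odd q'" "of_int q' * y = 2 ^ e' * of_int p'"
    using assms by (auto simp: two_pow_ideal_def)
  have "of_int (q * q') * (x * y) = (of_int q * x) * (of_int q' * y)"
    by (simp add: algebra_simps)
  also have "\<dots> = 2 ^ (e + e') * of_int (p * p')"
    unfolding 1 2 by (simp add: algebra_simps power_add)
  finally show ?thesis by (rule two_pow_idealI[rotated]) (use 1 2 in simp)
qed

lemma two_pow_ideal_sum:
  "(\<And>i. i \<in> I \<Longrightarrow> f i \<in> two_pow_ideal e) \<Longrightarrow> sum f I \<in> two_pow_ideal e"
  by (induction I rule: infinite_finite_induct) (auto intro: two_pow_ideal_add)

lemma two_pow_ideal_of_nat: "2 ^ e dvd (x::nat) \<Longrightarrow> of_nat x \<in> two_pow_ideal e"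
  by (elim dvdE, rule two_pow_idealI[of 1 _ _ "int (x div 2 ^ e)"]) simp_all


text \<open>\<open>(r + 1) div 2\<close> is r/2 rounded up. No linear rate above 1/2 is possible,
  since the coefficient of v^2 in \<open>tail_fps\<close> is 2.\<close>

definition half_growth :: "rat fps \<Rightarrow> bool" where
  "half_growth a \<longleftrightarrow> a $ 0 = 1 \<and> (\<forall>r. a $ r \<in> two_pow_ideal ((r + 1) div 2))"

text \<open>Rounding up is subadditive, so every term of the Cauchy product meets the bound.\<close>

lemma half_growth_mult:
  assumes "half_growth a" "half_growth b" shows "half_growth (a * b)"
proof -
  have "a $ i * b $ (r - i) \<in> two_pow_ideal ((r + 1) div 2)" if "i \<le> r" for i r
  proof (rule two_pow_ideal_mono)
    show "a $ i * b $ (r - i) \<in> two_pow_ideal ((i + 1) div 2 + (r - i + 1) div 2)"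
      using assms by (intro two_pow_ideal_mult) (auto simp: half_growth_def)
    show "(r + 1) div 2 \<le> (i + 1) div 2 + (r - i + 1) div 2"
      using that by presburger
  qed
  then show ?thesis using assms
    by (auto simp: half_growth_def fps_mult_nth intro!: two_pow_ideal_sum)
qed

lemma half_growth_power: 
  assumes "half_growth a" shows "half_growth (a ^ i)"
proof (induction i)
  case 0
  have "(1::rat) \<in> two_pow_ideal 0" by (rule two_pow_idealI[of 1 _ _ 1]) simp_all
  then show ?case by (auto simp: half_growth_def)
qed (simp add: half_growth_mult assms)

lemma half_growth_geo: "half_growth geo_fps"
proof -
  have "(-2) ^ r \<in> two_pow_ideal ((r + 1) div 2)" for r
  proof (rule two_pow_ideal_mono)
    show "(-2) ^ r \<in> two_pow_ideal r"
      by (rule two_pow_idealI[of 1 _ _ "(-1) ^ r"]) (simp_all flip: power_mult_distrib)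
  qed presburger
  then show ?thesis by (simp add: half_growth_def geo_fps_def)
qed

text \<open>With e the valuation of r + 2, the coefficient has valuation r + 1 - e. From 2e \<le>
  2^e \<le> r + 2 this is at least r/2.\<close>

lemma half_growth_tail: "half_growth tail_fps"
proof -
  have "tail_fps $ r \<in> two_pow_ideal ((r + 1) div 2)" for r
  proof -
    define e where "e = multiplicity 2 (r + 2)"
    obtain q where q: "r + 2 = 2 ^ e * q" "odd q"
      unfolding e_def using multiplicity_decompose'[of "r + 2" 2] by auto
    have "2 * e \<le> 2 ^ e"
    proof (induction e)
      case (Suc e) then show ?case by (cases e) simp_all
    qed simp
    also have "(2::nat) ^ e \<le> r + 2" using q by (intro dvd_imp_le) (auto simp del: add_2_eq_Suc' intro: odd_pos)
    finally have e: "2 * e \<le> r + 2" .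
    define d where "d = Suc r - e"
    have d: "Suc r = d + e" "(r + 1) div 2 \<le> d" using e by (auto simp: d_def)
    have "tail_fps $ r = - ((-2) ^ (d + e)) / of_nat (2 ^ e * q)"
      unfolding tail_fps_def d(1)[symmetric] q(1)[symmetric] by simp
    then have "of_int (int q) * tail_fps $ r = - ((-2) ^ (d + e)) / 2 ^ e"
      using q(2) by (cases "q = 0") (simp_all add: field_simps)
    also have "\<dots> = 2 ^ d * of_int (- ((-1) ^ (d + e)))"
      by (subst power_minus) (simp add: power_add)
    finally have "tail_fps $ r \<in> two_pow_ideal d"
      by (rule two_pow_idealI[rotated]) (use q(2) in simp)
    then show ?thesis using d(2) two_pow_ideal_mono by blast
  qed
  then show ?thesis by (simp add: half_growth_def tail_fps_def)
qed


section \<open>Binary digit sums and valuations of binomials\<close>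

lemma nu2_mult: "x \<noteq> 0 \<Longrightarrow> y \<noteq> 0 \<Longrightarrow> nu2 (x * y) = nu2 x + nu2 y"
  by (simp add: prime_elem_multiplicity_mult_distrib)

text \<open>Frees the range of summation from m, so that the digits of m and of
  \<open>m div 2\<close> can be aligned.\<close>

lemma sigma2_eq_sum:
  assumes "m < 2 ^ N" shows "sigma2 m = (\<Sum>i<N. m div 2 ^ i mod 2)"
proof -
  have less: "m div 2 ^ i = 0" if "N \<le> i \<or> m \<le> i" for i
  proof -
    have "m < 2 ^ i"
      using that assms less_exp[of m] power_increasing[of _ i "2::nat"] by (meson le_trans less_le_trans one_le_numeral)
    then show ?thesis by simp
  qed
  have "sigma2 m = (\<Sum>i<max m N. m div 2 ^ i mod 2)"
    unfolding sigma2_def by (intro sum.mono_neutral_left) (auto simp: less)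
  also have "\<dots> = (\<Sum>i<N. m div 2 ^ i mod 2)"
    by (intro sum.mono_neutral_right) (auto simp: less)
  finally show ?thesis .
qed

lemma sigma2_rec: "sigma2 m = m mod 2 + sigma2 (m div 2)"
proof -
  have m: "m < 2 ^ Suc m" "m div 2 < 2 ^ m"
    using less_exp[of m] less_exp[of "Suc m"] by (auto intro: le_less_trans[OF div_le_dividend])
  show ?thesis
    unfolding sigma2_eq_sum[OF m(1)] sigma2_eq_sum[OF m(2)] sum.lessThan_Suc_shift
    by (simp add: div_mult2_eq)
qed

lemma sigma2_double [simp]: "sigma2 (2 * m) = sigma2 m"
  by (subst sigma2_rec) simp

lemma sigma2_double_Suc [simp]: "sigma2 (Suc (2 * m)) = Suc (sigma2 m)"
  by (subst sigma2_rec) simp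

lemma sigma2_split: "y < 2 ^ h \<Longrightarrow> sigma2 (x * 2 ^ h + y) = sigma2 x + sigma2 y"
proof (induction h arbitrary: y)
  case 0
  then show ?case by (simp add: sigma2_def)
next
  case (Suc h)
  then have y: "y div 2 < 2 ^ h" by (simp add: less_mult_imp_div_less mult.commute)
  have "sigma2 (x * 2 ^ Suc h + y) = y mod 2 + sigma2 (x * 2 ^ h + y div 2)"
    by (subst sigma2_rec) (simp add: mult.left_commute[of x])
  also have "\<dots> = y mod 2 + (sigma2 x + sigma2 (y div 2))"
    unfolding Suc.IH[OF y] ..
  also have "\<dots> = sigma2 x + sigma2 y"
    by (subst (3) sigma2_rec) simp
  finally show ?case .
qed

text \<open>Adding 1 clears the trailing ones, \<open>nu2 (Suc m)\<close> in number, and sets the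
  next digit.\<close>

lemma sigma2_Suc: "sigma2 (Suc m) + nu2 (Suc m) = Suc (sigma2 m)"
proof (induction m rule: less_induct)
  case (less m)
  show ?case
  proof (cases "even m")
    case True
    then show ?thesis by (auto elim!: evenE simp: not_dvd_imp_multiplicity_0)
  next
    case False
    then obtain l where l: "m = Suc (2 * l)" by (auto elim: oddE)
    have "nu2 (Suc m) = nu2 (2 * Suc l)" using l by simp
    also have "\<dots> = Suc (nu2 (Suc l))" by (subst nu2_mult) simp_all
    finally have 1: "nu2 (Suc m) = Suc (nu2 (Suc l))" .
    have "sigma2 (Suc m) = sigma2 (2 * Suc l)" using l by simp
    then have 2: "sigma2 (Suc m) = sigma2 (Suc l)" unfolding sigma2_double .
    show ?thesis using less[of l] l 1 2 by simp
  qed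
qed

text \<open>Legendre's formula, by telescoping \<open>sigma2_Suc\<close>.\<close>

lemma nu2_fact: "nu2 (fact m) + sigma2 m = m"
proof (induction m)
  case 0
  then show ?case by (simp add: sigma2_def)
next
  case (Suc m)
  have "nu2 (fact (Suc m)) = nu2 (Suc m) + nu2 (fact m)"
    unfolding fact_Suc of_nat_id by (rule nu2_mult) simp_all
  then show ?case using Suc sigma2_Suc[of m] by simp
qed

lemma nu2_binomial: "nu2 ((x + y) choose x) + sigma2 (x + y) = sigma2 x + sigma2 y"
proof -
  have "nu2 (fact (x + y)) = nu2 (fact x * fact y * ((x + y) choose x))"
    using binomial_fact_lemma[of x "x + y"] by simp
  also have "\<dots> = nu2 (fact x) + nu2 (fact y) + nu2 ((x + y) choose x)"
    by (simp add: nu2_mult)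
  finally show ?thesis
    using nu2_fact[of x] nu2_fact[of y] nu2_fact[of "x + y"] by linarith
qed

text \<open>The low digits r meet only zeros of c 2^h, so they cause no carry and their digit sum
  cancels.\<close>

lemma nu2_binomial_shift:
  assumes "r < 2 ^ h"
  shows "nu2 ((c * 2 ^ h + (d * 2 ^ h + r)) choose (c * 2 ^ h)) = nu2 ((c + d) choose c)"
proof -
  have "c * 2 ^ h + (d * 2 ^ h + r) = (c + d) * 2 ^ h + r" by (simp add: algebra_simps)
  then have "sigma2 (c * 2 ^ h + (d * 2 ^ h + r)) = sigma2 (c + d) + sigma2 r"
    by (simp only: sigma2_split[OF assms])
  then show ?thesis
    using nu2_binomial[of "c * 2 ^ h" "d * 2 ^ h + r"] nu2_binomial[of c d]
      sigma2_split[OF assms] sigma2_split[of 0 h c] by (simp add: sigma2_def[of 0])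
qed

section \<open>Valuation of the Stirling numbers\<close>

lemma fps_coeff_cong:
  assumes a: "1 \<le> a" "a \<le> 2 ^ (h - 1)" and h: "h > 0"
    and nu: "4 * nu2 ((c + d) choose c) \<le> 2 ^ h"
    and m: "m = d * 2 ^ h + (2 ^ h - a)"
  shows "(geo_fps * inverse log_fps ^ Suc (c * 2 ^ h)) $ m - of_nat ((c * 2 ^ h + m) choose (c * 2 ^ h))
     \<in> two_pow_ideal (Suc (nu2 ((c + d) choose c)))"
proof -
  define n where "n = c * 2 ^ h"
  define v where "v = nu2 ((c + d) choose c)"
  have pow: "(2::nat) ^ h = 2 * 2 ^ (h - 1)" using h by (cases h) simp_all
  let ?t = "\<lambda>i. of_nat ((n + i) choose n) * (geo_fps * tail_fps ^ i) $ (m - i)"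
  have hg: "half_growth (geo_fps * tail_fps ^ i)" for i
    by (intro half_growth_mult half_growth_power half_growth_geo half_growth_tail)
  have "(geo_fps * inverse log_fps ^ Suc n) $ m = (\<Sum>i\<le>m. ?t i)"
    by (rule inverse_log_fps_power_expansion)
  also have "\<dots> = (\<Sum>i<m. ?t i) + of_nat ((n + m) choose n)"
    using hg[of m] by (simp add: half_growth_def flip: lessThan_Suc_atMost)
  finally have eq: "(geo_fps * inverse log_fps ^ Suc n) $ m - of_nat ((n + m) choose n) = (\<Sum>i<m. ?t i)"
    by simp
  have "?t i \<in> two_pow_ideal (Suc v)" if i: "i < m" for i
  proof -
    have e: "(geo_fps * tail_fps ^ i) $ (m - i) \<in> two_pow_ideal ((m - i + 1) div 2)"
      using hg[of i] by (simp add: half_growth_def)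
    show ?thesis
    proof (cases "d * 2 ^ h \<le> i")
      \<comment> \<open>The binomial supplies v factors 2, and m - i \<ge> 1 supplies one
        more.\<close>
      case True
      define r where "r = i - d * 2 ^ h"
      have r: "i = d * 2 ^ h + r" "r < 2 ^ h" using True i m by (auto simp: r_def)
      have "nu2 ((n + i) choose n) = v"
        unfolding n_def v_def r(1) by (rule nu2_binomial_shift) (fact r(2))
      then have "of_nat ((n + i) choose n) \<in> two_pow_ideal v"
        by (intro two_pow_ideal_of_nat) (metis multiplicity_dvd)
      from two_pow_ideal_mult[OF this e] show ?thesis
        by (rule two_pow_ideal_mono) (use i in presburger)
    next
      \<comment> \<open>The series coefficient alone suffices: m - i > 2^h - a \<ge> 2^(h-1) \<ge>
        2v, and (2v + 1)/2 rounds up to v + 1.\<close>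
      case False
      then have "2 * v + 1 \<le> m - i" using nu a pow m unfolding v_def by linarith
      then have "Suc v \<le> 0 + (m - i + 1) div 2" by linarith
      moreover have "of_nat ((n + i) choose n) \<in> two_pow_ideal 0"
        by (rule two_pow_ideal_of_nat) simp
      ultimately show ?thesis using two_pow_ideal_mult[OF _ e] two_pow_ideal_mono by blast
    qed
  qed
  then have "(\<Sum>i<m. ?t i) \<in> two_pow_ideal (Suc v)" by (intro two_pow_ideal_sum) simp
  then show ?thesis unfolding eq[symmetric] unfolding n_def v_def .
qed

text \<open>The congruence forces the coefficient to have the valuation of the binomial. Taking
  valuations in \<open>Stirling_eq_fps_coeff\<close>, Legendre's formula turns the factorials into
  digit sums and the terms n, k and n - k cancel.\<close>

lemma nu2_Stirling:
  assumes "k \<le> n" 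
    and "(geo_fps * inverse log_fps ^ Suc n) $ (n - k) - of_nat ((n + (n - k)) choose n)
      \<in> two_pow_ideal (Suc (nu2 ((n + (n - k)) choose n)))"
  shows "nu2 (Stirling n k) + sigma2 n = sigma2 k + nu2 ((n + (n - k)) choose n)"
proof -
  define B where "B = (n + (n - k)) choose n"
  have "B \<noteq> 0" by (simp add: B_def)
  define N where "N = (geo_fps * inverse log_fps ^ Suc n) $ (n - k)"
  obtain p q where q: "odd q" and p: "of_int q * (N - of_nat B) = 2 ^ Suc (nu2 B) * of_int p"
    using assms(2) unfolding B_def N_def two_pow_ideal_def by blast
  \<comment> \<open>Clearing the odd denominator q gives an integer M = qN, congruent to qB modulo
    one power of 2 more than divides B.\<close>
  define M where "M = q * int B + 2 ^ Suc (nu2 B) * p"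
  have M: "of_int M = of_int q * N" using p by (simp add: M_def algebra_simps)
  have int_dvd: "2 ^ e dvd int B \<longleftrightarrow> 2 ^ e dvd B" for e
    by (metis int_dvd_int_iff of_nat_numeral of_nat_power)
  have nat_dvd: "2 ^ e dvd nat \<bar>M\<bar> \<longleftrightarrow> 2 ^ e dvd M" for e
    by (simp add: dvd_nat_abs_iff)
  have M_not_dvd: "\<not> 2 ^ Suc (nu2 B) dvd nat \<bar>M\<bar>"
  proof -
    have "\<not> 2 ^ Suc (nu2 B) dvd int B"
      unfolding int_dvd using \<open>B \<noteq> 0\<close> by (subst power_dvd_iff_le_multiplicity) simp_all
    moreover have "coprime (2 ^ Suc (nu2 B)) q" using q by simp
    ultimately have "\<not> 2 ^ Suc (nu2 B) dvd q * int B"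
      using coprime_dvd_mult_right_iff by blast
    then show ?thesis
      unfolding nat_dvd unfolding M_def by (subst dvd_add_left_iff) simp_all
  qed
  have nuM: "nu2 (nat \<bar>M\<bar>) = nu2 B"
  proof (rule multiplicity_eqI)
    have "2 ^ nu2 B dvd int B" unfolding int_dvd by (rule multiplicity_dvd)
    then show "2 ^ nu2 B dvd nat \<bar>M\<bar>" unfolding nat_dvd by (simp add: M_def)
  qed (fact M_not_dvd)
  have nuq: "nu2 (nat \<bar>q\<bar>) = 0" using q by (intro not_dvd_imp_multiplicity_0) (simp add: even_nat_iff)
  have "rat_of_int (q * int (Stirling n k * fact k * 2 ^ (n - k))) = of_int (int (fact n) * M)"
    using Stirling_eq_fps_coeff[OF assms(1)] by (simp add: M N_def mult.left_commute)
  then have "q * int (Stirling n k * fact k * 2 ^ (n - k)) = int (fact n) * M"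
    by (simp only: of_int_eq_iff)
  then have "nat \<bar>q * int (Stirling n k * fact k * 2 ^ (n - k))\<bar> = nat \<bar>int (fact n) * M\<bar>"
    by simp
  then have eq: "nat \<bar>q\<bar> * (Stirling n k * fact k * 2 ^ (n - k)) = fact n * nat \<bar>M\<bar>"
    by (simp add: abs_mult nat_mult_distrib del: of_nat_mult of_nat_power of_nat_fact)
  \<comment> \<open>\<open>multiplicity\<close> is 0 at 0 by convention, so additivity of
    \<open>nu2\<close> needs nonzero factors.\<close>
  have "nat \<bar>M\<bar> \<noteq> 0" using M_not_dvd by (metis dvd_0_right)
  then have nz: "nat \<bar>q\<bar> \<noteq> 0" "Stirling n k \<noteq> 0"
    using eq by (metis fact_nonzero mult_eq_0_iff)+
  have "nu2 (nat \<bar>q\<bar>) + (nu2 (Stirling n k) + nu2 (fact k) + (n - k)) = nu2 (fact n) + nu2 (nat \<bar>M\<bar>)"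
    using arg_cong[OF eq, of nu2] nz \<open>nat \<bar>M\<bar> \<noteq> 0\<close> by (simp add: nu2_mult)
  then show ?thesis
    using nuq nuM nu2_fact[of k] nu2_fact[of n] assms(1) unfolding B_def by linarith
qed

text \<open>With d = c - b - 1 and b odd, c + d is even and 2c - b is its successor, so its digit
  sum is one larger. This 1 cancels the one from \<open>sigma2_Suc\<close> at d.\<close>

lemma f_shift_odd:
  assumes "b < c" "odd b"
  shows "f_shift b c = int (nu2 (c - b)) + int (nu2 ((2 * c - b) choose b))"
proof -
  obtain d where d: "c = b + Suc d" using assms(1) less_imp_Suc_add by auto
  obtain l where l: "b = Suc (2 * l)" using assms(2) by (auto elim: oddE)
  have 1: "2 * c - b - 1 = c + d" "2 * c - b = b + 2 * Suc d" "c - b = Suc d" using d by auto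
  have "sigma2 (2 * Suc d) = sigma2 (Suc d)" by (rule sigma2_double)
  moreover have "b + 2 * Suc d = Suc (2 * (l + Suc d))" "c + d = 2 * (l + Suc d)" using l d by auto
  then have "sigma2 (b + 2 * Suc d) = Suc (sigma2 (c + d))" by (simp only: sigma2_double_Suc sigma2_double)
  ultimately show ?thesis unfolding f_shift_def 1(1) unfolding 1(2,3)
    using nu2_binomial[of c d] nu2_binomial[of b "2 * Suc d"] sigma2_Suc[of d] by linarith
qed

theorem theorem3p1:
  fixes a b c h n k :: nat
  assumes "a > 0" and "c > 1" and "h > 0"
    and "n = c * 2 ^ h"
    and "1 \<le> a" and "a \<le> 2 ^ (h - 1)"
    and "k = b * 2 ^ h + a" and "k < n"
    and "(2::real) powi (int h - 2) \<ge> real (nu2 ((2 * c - b - 1) choose c))"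
  shows "int (nu2 (Stirling n k))
           = int (sigma2 k) - int (sigma2 n) + int (nu2 ((n - k + n) choose n))
       \<and> int (sigma2 k) - int (sigma2 n) + int (nu2 ((n - k + n) choose n))
           = int (sigma2 a) + f_shift b c
       \<and> (odd b \<longrightarrow>
            f_shift b c = int (nu2 (c - b)) + int (nu2 ((2 * c - b) choose b))
          \<and> int (nu2 (Stirling n k))
              = int (sigma2 a) + int (nu2 (c - b)) + int (nu2 ((2 * c - b) choose b)))"
proof -
  have "b * 2 ^ h < c * 2 ^ h" using assms(4,7,8) by linarith
  then have "b < c" by simp
  then obtain d where d: "c = b + Suc d" using less_imp_Suc_add by auto
  then have cd: "2 * c - b - 1 = c + d" by linarith
  have "(2::nat) ^ (h - 1) < 2 ^ h" using assms(3) by simp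
  then have a: "a < 2 ^ h" using assms(6) by linarith
  have m: "n - k = d * 2 ^ h + (2 ^ h - a)"
    unfolding assms(4,7) d using a by (simp add: algebra_simps)
  \<comment> \<open>Multiplying by 4 removes the exponent h - 2, which is negative for h =
    1.\<close>
  have nu: "4 * nu2 ((c + d) choose c) \<le> 2 ^ h"
  proof -
    have "real (4 * nu2 ((c + d) choose c)) \<le> 4 * 2 powi (int h - 2)"
      using assms(9) unfolding cd by simp
    also have "\<dots> = real (2 ^ h)" by (simp add: power_int_diff)
    finally show ?thesis by (simp only: of_nat_le_iff)
  qed
  \<comment> \<open>Positivity of a makes 2^h - a a valid low part, below 2^h.\<close>
  have binom: "nu2 ((n + (n - k)) choose n) = nu2 ((c + d) choose c)"
    unfolding m unfolding assms(4) by (rule nu2_binomial_shift) (use assms(1) in simp)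
  have "nu2 (Stirling n k) + sigma2 n = sigma2 k + nu2 ((n + (n - k)) choose n)"
    using fps_coeff_cong[OF assms(5,6,3) nu m] assms(8)
    by (intro nu2_Stirling) (simp_all only: binom less_imp_le flip: assms(4))
  moreover have "sigma2 n = sigma2 c"
    unfolding assms(4) using sigma2_split[of 0 h c] by (simp add: sigma2_def[of 0])
  moreover have "sigma2 k = sigma2 b + sigma2 a"
    unfolding assms(7) by (rule sigma2_split) (fact a)
  ultimately have "int (nu2 (Stirling n k)) = int (sigma2 k) - int (sigma2 n) + int (nu2 ((n - k + n) choose n))"
    and "int (sigma2 k) - int (sigma2 n) + int (nu2 ((n - k + n) choose n)) = int (sigma2 a) + f_shift b c"
    unfolding f_shift_def add.commute[of "n - k" n] binom cd by linarith+
  then show ?thesis using f_shift_odd[OF \<open>b < c\<close>] by simp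
qed

end
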